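(* Let $G=(V,E)$ be a connected finite graph with positive symmetric edge weights $w_{xy}$ and a measure $\mu:V\to\mathbb{R}^{+}$, and let $h:V\to\mathbb{R}$ be a positive function. Let $$\mathbf{H}=\left\{u\in \mathbf{W}^{1,2}(V)\;\Big|\;\int_V u\,d\mu=0\right\},\qquad J_\beta(u)=\frac12\int_V|\nabla u|^2\,d\mu-\beta\log\int_V he^u\,d\mu .$$ Then for any $\beta\in\mathbb{R}$, $J_\beta$ has a minimizer in $\mathbf{H}$, i.e. there is $u\in\mathbf{H}$ with $J_\beta(u)=\inf_{v\in\mathbf{H}}J_\beta(v)$. Moreover, the Kazdan-Warner equation $$\Delta u=-\frac{\beta he^{u}}{\int_V he^{u}\,d\mu}+\frac{\beta}{\mathrm{Vol}(V)}\quad\text{on } V$$ has a solution $u\in\mathbf{H}$.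
   Context: $G=(V,E)$ is a finite connected graph; each edge $xy\in E$ has a weight $w_{xy}>0$ with $w_{xy}=w_{yx}$; $y\sim x$ means $xy\in E$; $\mu:V\to\mathbb{R}^{+}$ is a positive finite measure. For $u:V\to\mathbb{R}$, $$\Delta u(x)=\frac{1}{\mu(x)}\sum_{y\sim x}w_{xy}[u(y)-u(x)],\qquad |\nabla u|(x)=\left\{\frac{1}{2\mu(x)}\sum_{y\sim x}w_{xy}[u(y)-u(x)]^2\right\}^{1/2}.$$ For $g:V\to\mathbb{R}$, $\int_V g\,d\mu=\sum_{x\in V}\mu(x)g(x)$, and $\mathrm{Vol}(V)=\sum_{x\in V}\mu(x)$. The Sobolev space is $\mathbf{W}^{1,2}(V)=\{u:V\to\mathbb{R}\mid\int_V(|\nabla u|^2+u^2)\,d\mu<+\infty\}$ (since $V$ is finite, this is the space of all functions on $V$). *)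

theory Defs
  imports
    "HOL-Library.FuncSet"
    "HOL-Library.Extended_Real"
    "Graph_Theory.Digraph_Component"
begin

text \<open>
  An undirected graph \<open>(V, E)\<close> is a \<^locale>\<open>pair_pseudo_graph\<close>: \<open>V = pverts G\<close> is finite, and
  \<open>parcs G\<close> is a symmetric relation containing both orientations of each edge, so that
  \<open>y \<sim> x\<close> reads \<open>(x, y) \<in> parcs G\<close>. Loops are not excluded; they contribute nothing to the
  operators below.
\<close>

definition laplacian ::
    "'a pair_pre_digraph \<Rightarrow> ('a \<Rightarrow> 'a \<Rightarrow> real) \<Rightarrow> ('a \<Rightarrow> real) \<Rightarrow> ('a \<Rightarrow> real) \<Rightarrow> 'a \<Rightarrow> real" where
  "laplacian G w \<mu> u x =
     1 / \<mu> x * (\<Sum>y\<in>{y. (x, y) \<in> parcs G}. w x y * (u y - u x))"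

definition grad_norm ::
    "'a pair_pre_digraph \<Rightarrow> ('a \<Rightarrow> 'a \<Rightarrow> real) \<Rightarrow> ('a \<Rightarrow> real) \<Rightarrow> ('a \<Rightarrow> real) \<Rightarrow> 'a \<Rightarrow> real" where
  "grad_norm G w \<mu> u x =
     sqrt (1 / (2 * \<mu> x) * (\<Sum>y\<in>{y. (x, y) \<in> parcs G}. w x y * (u y - u x)\<^sup>2))"

definition vintegral :: "'a pair_pre_digraph \<Rightarrow> ('a \<Rightarrow> real) \<Rightarrow> ('a \<Rightarrow> real) \<Rightarrow> real" where
  "vintegral G \<mu> g = (\<Sum>x\<in>pverts G. \<mu> x * g x)"

definition vol :: "'a pair_pre_digraph \<Rightarrow> ('a \<Rightarrow> real) \<Rightarrow> real" where
  "vol G \<mu> = (\<Sum>x\<in>pverts G. \<mu> x)"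

text \<open>
  Functions \<open>V \<rightarrow> \<real>\<close> are represented by extensional functions on \<open>pverts G\<close>. The integrability
  condition always holds, as the integral is a finite sum.
\<close>

definition W12 ::
    "'a pair_pre_digraph \<Rightarrow> ('a \<Rightarrow> 'a \<Rightarrow> real) \<Rightarrow> ('a \<Rightarrow> real) \<Rightarrow> ('a \<Rightarrow> real) set" where
  "W12 G w \<mu> =
     {u \<in> pverts G \<rightarrow>\<^sub>E UNIV.
        ereal (vintegral G \<mu> (\<lambda>x. (grad_norm G w \<mu> u x)\<^sup>2 + (u x)\<^sup>2)) < \<infinity>}"

definition mean_zero_W12 ::
    "'a pair_pre_digraph \<Rightarrow> ('a \<Rightarrow> 'a \<Rightarrow> real) \<Rightarrow> ('a \<Rightarrow> real) \<Rightarrow> ('a \<Rightarrow> real) set" where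
  "mean_zero_W12 G w \<mu> = {u \<in> W12 G w \<mu>. vintegral G \<mu> u = 0}"

definition J_functional ::
    "'a pair_pre_digraph \<Rightarrow> ('a \<Rightarrow> 'a \<Rightarrow> real) \<Rightarrow> ('a \<Rightarrow> real) \<Rightarrow> ('a \<Rightarrow> real) \<Rightarrow> real \<Rightarrow>
       ('a \<Rightarrow> real) \<Rightarrow> real" where
  "J_functional G w \<mu> h \<beta> u =
     1 / 2 * vintegral G \<mu> (\<lambda>x. (grad_norm G w \<mu> u x)\<^sup>2)
       - \<beta> * ln (vintegral G \<mu> (\<lambda>x. h x * exp (u x)))"

definition kazdan_warner_solution ::
    "'a pair_pre_digraph \<Rightarrow> ('a \<Rightarrow> 'a \<Rightarrow> real) \<Rightarrow> ('a \<Rightarrow> real) \<Rightarrow> ('a \<Rightarrow> real) \<Rightarrow> real \<Rightarrow>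
       ('a \<Rightarrow> real) \<Rightarrow> bool" where
  "kazdan_warner_solution G w \<mu> h \<beta> u \<longleftrightarrow>
     (\<forall>x\<in>pverts G.
        laplacian G w \<mu> u x =
          - (\<beta> * h x * exp (u x) / vintegral G \<mu> (\<lambda>y. h y * exp (u y))) + \<beta> / vol G \<mu>)"

end

theory Submission
  imports Defs "HOL-Analysis.Function_Topology"
begin

text \<open>
  On the mean-zero functions the Dirichlet energy \<open>E(u) = \<integral>|\<nabla>u|\<^sup>2 d\<mu>\<close> controls \<open>sup |u|\<close>: along an
  arc the increment of \<open>u\<close> is at most a constant times \<open>\<surd>E(u)\<close>, hence along a path, hence between
  any two vertices of a finite connected graph (\<open>oscillation_le_energy\<close>); a function of mean zero
  is an average of its own increments, so \<open>|u| \<le> C \<surd>E(u)\<close> (\<open>poincare_sup\<close>). The logarithmic term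
  of the functional grows only linearly in \<open>sup |u|\<close>, for either sign of \<open>\<beta>\<close>, and is beaten by the
  quadratic energy. So the sublevel sets of the functional are bounded, and minimizing it over
  \<open>H\<close> amounts to minimizing a continuous function over a compact set
  (\<open>J_minimizer_exists\<close>).

  A minimizer satisfies the equation. Differentiating along a mean-zero \<open>\<phi>\<close> and using Green's
  formula gives \<open>\<integral> \<phi> F d\<mu> = 0\<close>, where \<open>F = \<Delta>u + \<beta> h e\<^sup>u / \<integral> h e\<^sup>u d\<mu>\<close>. Taking \<open>\<phi>\<close> to be \<open>F\<close> minus
  its mean shows that \<open>F\<close> is constant, and since \<open>\<integral> \<Delta>u d\<mu> = 0\<close> this constant, the Lagrange
  multiplier of the constraint \<open>\<integral> u d\<mu> = 0\<close>, can only be \<open>\<beta> / Vol(V)\<close>.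
\<close>

section \<open>Green's formula\<close>

locale weighted_graph = pair_pseudo_graph G
  for G :: "'a pair_pre_digraph" +
  fixes w :: "'a \<Rightarrow> 'a \<Rightarrow> real" and \<mu> :: "'a \<Rightarrow> real"
  assumes graph_connected: "Digraph_Component.connected (with_proj G)"
    and w_pos: "\<And>x y. (x, y) \<in> parcs G \<Longrightarrow> w x y > 0"
    and w_sym: "\<And>x y. (x, y) \<in> parcs G \<Longrightarrow> w x y = w y x"
    and mu_pos: "\<And>x. x \<in> pverts G \<Longrightarrow> \<mu> x > 0"
begin

text \<open>The factor \<open>1/2\<close> compensates for both orientations of each edge being summed.\<close>

definition dirichlet_form :: "('a \<Rightarrow> real) \<Rightarrow> ('a \<Rightarrow> real) \<Rightarrow> real" where
  "dirichlet_form u v = (\<Sum>(x, y)\<in>parcs G. w x y * (u y - u x) * (v y - v x)) / 2"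

abbreviation integral_V :: "('a \<Rightarrow> real) \<Rightarrow> real" (\<open>\<integral>\<^sub>V\<close>) where
  "integral_V \<equiv> vintegral G \<mu>"

lemma vertices_nonempty: "pverts G \<noteq> {}"
  using graph_connected by (auto simp: connected_conv)

lemma vol_pos: "vol G \<mu> > 0"
  unfolding vol_def using vertices_nonempty pair_finite_verts mu_pos by (intro sum_pos) auto

lemma vertices_reachable:
  assumes "x \<in> pverts G" "y \<in> pverts G"
  shows "x \<rightarrow>\<^sup>*\<^bsub>with_proj G\<^esub> y"
proof -
  have "strongly_connected (with_proj G)"
    using symmetric_connected_imp_strongly_connected[OF pair_sym_arcs graph_connected] .
  then show ?thesis using assms by (auto simp: strongly_connected_def)
qed

lemma finite_neighbours: "finite {y. (x, y) \<in> parcs G}"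
  by (rule finite_subset[OF _ pair_finite_verts]) (auto dest: in_arcsD2)

lemma sum_neighbours_eq_sum_arcs:
  fixes f :: "'a \<Rightarrow> 'a \<Rightarrow> real"
  shows "(\<Sum>x\<in>pverts G. \<Sum>y\<in>{y. (x, y) \<in> parcs G}. f x y) = (\<Sum>(x, y)\<in>parcs G. f x y)"
proof -
  have "parcs G = Sigma (pverts G) (\<lambda>x. {y. (x, y) \<in> parcs G})"
    by (auto dest: in_arcsD1)
  then show ?thesis
    using sum.Sigma[OF pair_finite_verts, of "\<lambda>x. {y. (x, y) \<in> parcs G}" f] finite_neighbours
    by simp
qed

lemma sum_arcs_swap:
  fixes f :: "'a \<Rightarrow> 'a \<Rightarrow> real"
  shows "(\<Sum>(x, y)\<in>parcs G. f x y) = (\<Sum>(x, y)\<in>parcs G. f y x)"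
proof -
  have "sym (parcs G)" using pair_sym_arcs by (simp add: symmetric_def)
  then have "bij_betw prod.swap (parcs G) (parcs G)"
    by (intro bij_betwI[where g = prod.swap]) (auto dest: symD)
  from sum.reindex_bij_betw[OF this, of "\<lambda>(x, y). f x y"] show ?thesis
    by (simp add: case_prod_unfold)
qed

lemma integral_cong: "(\<And>x. x \<in> pverts G \<Longrightarrow> f x = g x) \<Longrightarrow> \<integral>\<^sub>V f = \<integral>\<^sub>V g"
  by (simp add: vintegral_def)

lemma integral_add: "\<integral>\<^sub>V (\<lambda>x. f x + g x) = \<integral>\<^sub>V f + \<integral>\<^sub>V g"
  by (simp add: vintegral_def distrib_left sum.distrib)

lemma integral_cmult: "\<integral>\<^sub>V (\<lambda>x. c * f x) = c * \<integral>\<^sub>V f"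
  by (simp add: vintegral_def sum_distrib_left mult.left_commute)

lemma integral_const: "\<integral>\<^sub>V (\<lambda>x. c) = c * vol G \<mu>"
  by (simp add: vintegral_def vol_def sum_distrib_left mult.commute)

lemma integral_mono: "(\<And>x. x \<in> pverts G \<Longrightarrow> f x \<le> g x) \<Longrightarrow> \<integral>\<^sub>V f \<le> \<integral>\<^sub>V g"
  unfolding vintegral_def by (intro sum_mono mult_left_mono) (auto intro: less_imp_le mu_pos)

lemma integral_pos: "(\<And>x. x \<in> pverts G \<Longrightarrow> f x > 0) \<Longrightarrow> \<integral>\<^sub>V f > 0"
  unfolding vintegral_def using vertices_nonempty pair_finite_verts mu_pos by (intro sum_pos) auto

lemma integral_square_eq_0D:
  assumes "\<integral>\<^sub>V (\<lambda>x. (f x)\<^sup>2) = 0" "x \<in> pverts G"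
  shows "f x = 0"
proof -
  have "\<forall>x\<in>pverts G. \<mu> x * (f x)\<^sup>2 = 0"
    using assms(1) unfolding vintegral_def
    by (subst (asm) sum_nonneg_eq_0_iff) (auto intro!: mult_nonneg_nonneg pair_finite_verts less_imp_le[OF mu_pos])
  then show ?thesis using assms(2) mu_pos[OF assms(2)] by auto
qed

lemma continuous_integral:
  assumes "\<And>x. x \<in> pverts G \<Longrightarrow> continuous_on A (\<lambda>u. f u x)"
  shows "continuous_on A (\<lambda>u. \<integral>\<^sub>V (f u))"
  unfolding vintegral_def using assms by (intro continuous_intros) auto

lemma integral_grad_norm_sq: "\<integral>\<^sub>V (\<lambda>x. (grad_norm G w \<mu> u x)\<^sup>2) = dirichlet_form u u"
proof -
  have "\<mu> x * (grad_norm G w \<mu> u x)\<^sup>2 =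
      (\<Sum>y\<in>{y. (x, y) \<in> parcs G}. w x y * (u y - u x) * (u y - u x)) / 2" if "x \<in> pverts G" for x
  proof -
    have "(\<Sum>y\<in>{y. (x, y) \<in> parcs G}. w x y * (u y - u x)\<^sup>2) \<ge> 0"
      by (intro sum_nonneg mult_nonneg_nonneg) (auto intro: less_imp_le w_pos)
    then show ?thesis
      using mu_pos[OF that] by (simp add: grad_norm_def power2_eq_square mult.assoc)
  qed
  then have "\<integral>\<^sub>V (\<lambda>x. (grad_norm G w \<mu> u x)\<^sup>2) =
      (\<Sum>x\<in>pverts G. \<Sum>y\<in>{y. (x, y) \<in> parcs G}. w x y * (u y - u x) * (u y - u x)) / 2"
    by (simp add: vintegral_def sum_divide_distrib)
  then show ?thesis by (simp add: dirichlet_form_def sum_neighbours_eq_sum_arcs)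
qed

text \<open>
  Summation by parts: averaging the sum over all arcs with the one in which the two endpoints are
  exchanged replaces \<open>\<phi> x\<close> by half the increment of \<open>\<phi>\<close>.
\<close>

lemma green: "\<integral>\<^sub>V (\<lambda>x. laplacian G w \<mu> u x * \<phi> x) = - dirichlet_form u \<phi>"
proof -
  let ?f = "\<lambda>x y. w x y * (u y - u x) * \<phi> x"
  have "\<mu> x * (laplacian G w \<mu> u x * \<phi> x) = (\<Sum>y\<in>{y. (x, y) \<in> parcs G}. ?f x y)"
    if "x \<in> pverts G" for x
    using mu_pos[OF that] by (simp add: laplacian_def sum_distrib_right)
  then have 1: "\<integral>\<^sub>V (\<lambda>x. laplacian G w \<mu> u x * \<phi> x) = (\<Sum>(x, y)\<in>parcs G. ?f x y)"
    by (simp add: vintegral_def sum_neighbours_eq_sum_arcs)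
  have pointwise: "?f x y + ?f y x = - (w x y * (u y - u x) * (\<phi> y - \<phi> x))"
    if "(x, y) \<in> parcs G" for x y
    using w_sym[OF that] by (simp add: algebra_simps)
  have "(\<Sum>(x, y)\<in>parcs G. ?f x y) + (\<Sum>(x, y)\<in>parcs G. ?f y x)
      = (\<Sum>(x, y)\<in>parcs G. - (w x y * (u y - u x) * (\<phi> y - \<phi> x)))"
    unfolding sum.distrib[symmetric]
    by (intro sum.cong refl) (simp only: split_paired_all prod.case pointwise)
  also have "\<dots> = - 2 * dirichlet_form u \<phi>"
    by (simp add: dirichlet_form_def case_prod_unfold sum_negf)
  finally show ?thesis using 1 sum_arcs_swap[of ?f] by simp
qed

lemma integral_laplacian: "\<integral>\<^sub>V (laplacian G w \<mu> u) = 0"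
  using green[of u "\<lambda>_. 1"] by (simp add: dirichlet_form_def case_prod_unfold)

lemma dirichlet_form_cong:
  assumes "\<And>x. x \<in> pverts G \<Longrightarrow> u x = v x"
  shows "dirichlet_form u u = dirichlet_form v v"
proof -
  have "(\<Sum>(x, y)\<in>parcs G. w x y * (u y - u x) * (u y - u x)) =
      (\<Sum>(x, y)\<in>parcs G. w x y * (v y - v x) * (v y - v x))"
    by (intro sum.cong refl) (auto simp: assms in_arcsD1 in_arcsD2)
  then show ?thesis by (simp add: dirichlet_form_def)
qed

lemma dirichlet_form_nonneg: "dirichlet_form u u \<ge> 0"
  unfolding dirichlet_form_def
  by (auto intro!: sum_nonneg mult_nonneg_nonneg
      simp: mult.assoc less_imp_le w_pos simp flip: power2_eq_square)

lemma dirichlet_form_along_line: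
  "dirichlet_form (\<lambda>x. u x + t * \<phi> x) (\<lambda>x. u x + t * \<phi> x)
     = dirichlet_form u u + 2 * t * dirichlet_form u \<phi> + t\<^sup>2 * dirichlet_form \<phi> \<phi>"
proof -
  have "(\<Sum>(x, y)\<in>parcs G. w x y * ((u y + t * \<phi> y) - (u x + t * \<phi> x)) * ((u y + t * \<phi> y) - (u x + t * \<phi> x)))
     = (\<Sum>(x, y)\<in>parcs G. w x y * (u y - u x) * (u y - u x)) +
       2 * t * (\<Sum>(x, y)\<in>parcs G. w x y * (u y - u x) * (\<phi> y - \<phi> x)) +
       t\<^sup>2 * (\<Sum>(x, y)\<in>parcs G. w x y * (\<phi> y - \<phi> x) * (\<phi> y - \<phi> x))"
    unfolding sum_distrib_left sum.distrib[symmetric]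
    by (intro sum.cong refl) (auto simp: algebra_simps power2_eq_square)
  then show ?thesis by (simp add: dirichlet_form_def add_divide_distrib)
qed

lemma continuous_dirichlet_form: "continuous_on A (\<lambda>u. dirichlet_form u u)"
  unfolding dirichlet_form_def case_prod_unfold
  by (intro continuous_intros continuous_on_product_coordinates[THEN continuous_on_subset]) auto

section \<open>Energy bounds the supremum\<close>

lemma arc_increment_le_energy:
  assumes "(x, y) \<in> parcs G"
  shows "\<bar>u x - u y\<bar> \<le> sqrt (2 / w x y) * sqrt (dirichlet_form u u)"
proof -
  have "w x y * (u y - u x) * (u y - u x)
      \<le> (\<Sum>(x, y)\<in>parcs G. w x y * (u y - u x) * (u y - u x))"
    by (rule member_le_sum[OF assms, of "\<lambda>(x, y). w x y * (u y - u x) * (u y - u x)", simplified])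
      (auto simp: mult.assoc less_imp_le w_pos pair_finite_arcs)
  then have "w x y * (u x - u y)\<^sup>2 \<le> 2 * dirichlet_form u u"
    by (simp add: dirichlet_form_def power2_eq_square algebra_simps)
  then have "(u x - u y)\<^sup>2 \<le> 2 / w x y * dirichlet_form u u"
    using w_pos[OF assms] by (simp add: field_simps)
  then show ?thesis by (metis real_sqrt_abs real_sqrt_le_iff real_sqrt_mult)
qed

lemma reachable_increment_le_energy:
  assumes "x \<rightarrow>\<^sup>*\<^bsub>with_proj G\<^esub> y"
  shows "\<exists>C\<ge>0. \<forall>u. \<bar>u x - u y\<bar> \<le> C * sqrt (dirichlet_form u u)"
  using assms
proof (induction rule: reachable_induct)
  case base
  then show ?case by (intro exI[of _ 0]) simp
next
  case (step y z)
  then obtain C where C: "C \<ge> 0" "\<And>u. \<bar>u x - u y\<bar> \<le> C * sqrt (dirichlet_form u u)" by auto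
  have yz: "(y, z) \<in> parcs G" using step by simp
  have "\<bar>u x - u z\<bar> \<le> (C + sqrt (2 / w y z)) * sqrt (dirichlet_form u u)" for u
    using C(2)[of u] arc_increment_le_energy[OF yz, of u] by (simp add: distrib_right)
  moreover have "C + sqrt (2 / w y z) \<ge> 0" using C(1) w_pos[OF yz] by simp
  ultimately show ?case by blast
qed

text \<open>Finitely many pairs of vertices: the sum of their constants serves all of them.\<close>

lemma oscillation_le_energy:
  "\<exists>C\<ge>0. \<forall>u. \<forall>x\<in>pverts G. \<forall>y\<in>pverts G. \<bar>u x - u y\<bar> \<le> C * sqrt (dirichlet_form u u)"
proof -
  let ?P = "pverts G \<times> pverts G"
  have "\<forall>p\<in>?P. \<exists>C\<ge>0. \<forall>u. \<bar>u (fst p) - u (snd p)\<bar> \<le> C * sqrt (dirichlet_form u u)"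
    using reachable_increment_le_energy vertices_reachable by auto
  then obtain C where C: "\<forall>p\<in>?P. C p \<ge> 0 \<and>
      (\<forall>u. \<bar>u (fst p) - u (snd p)\<bar> \<le> C p * sqrt (dirichlet_form u u))"
    by (auto simp: bchoice_iff)
  have le: "C p \<le> sum C ?P" if "p \<in> ?P" for p
    using that C pair_finite_verts by (intro member_le_sum) auto
  have "\<bar>u x - u y\<bar> \<le> sum C ?P * sqrt (dirichlet_form u u)"
    if "x \<in> pverts G" "y \<in> pverts G" for u x y
  proof -
    have xy: "(x, y) \<in> ?P" using that by simp
    have "\<bar>u x - u y\<bar> \<le> C (x, y) * sqrt (dirichlet_form u u)" using C xy by fastforce
    also have "\<dots> \<le> sum C ?P * sqrt (dirichlet_form u u)"
      using le[OF xy] dirichlet_form_nonneg by (intro mult_right_mono) auto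
    finally show ?thesis .
  qed
  moreover have "sum C ?P \<ge> 0" using C by (intro sum_nonneg) auto
  ultimately show ?thesis by blast
qed

text \<open>
  A Poincare inequality in the supremum norm. If \<open>u\<close> has mean zero, then \<open>Vol(V) u(x)\<close> is the
  integral of \<open>u(x) - u(y)\<close> over \<open>y\<close>, which the oscillation bounds.
\<close>

lemma poincare_sup:
  "\<exists>C\<ge>0. \<forall>u. \<integral>\<^sub>V u = 0 \<longrightarrow> (\<forall>x\<in>pverts G. \<bar>u x\<bar> \<le> C * sqrt (dirichlet_form u u))"
proof -
  obtain C where C: "C \<ge> 0"
      "\<And>u x y. x \<in> pverts G \<Longrightarrow> y \<in> pverts G \<Longrightarrow> \<bar>u x - u y\<bar> \<le> C * sqrt (dirichlet_form u u)"
    using oscillation_le_energy by blast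
  have "\<bar>u x\<bar> \<le> C * sqrt (dirichlet_form u u)" if u: "\<integral>\<^sub>V u = 0" and x: "x \<in> pverts G" for u x
  proof -
    let ?B = "C * sqrt (dirichlet_form u u)"
    have "u x * vol G \<mu> = \<integral>\<^sub>V (\<lambda>y. u x + - 1 * u y)"
      using u by (simp only: integral_add integral_cmult integral_const)
    moreover have "\<integral>\<^sub>V (\<lambda>y. u x + - 1 * u y) \<le> \<integral>\<^sub>V (\<lambda>y. ?B)"
      using C(2)[OF x, of _ u] by (intro integral_mono) (simp add: abs_le_iff)
    moreover have "\<integral>\<^sub>V (\<lambda>y. - ?B) \<le> \<integral>\<^sub>V (\<lambda>y. u x + - 1 * u y)"
      using C(2)[OF x, of _ u] by (intro integral_mono) (smt (verit))
    ultimately have "u x * vol G \<mu> \<le> ?B * vol G \<mu>" "- ?B * vol G \<mu> \<le> u x * vol G \<mu>"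
      by (simp_all only: integral_const)
    then have "u x \<le> ?B" "- ?B \<le> u x"
      using vol_pos by (simp_all only: mult_le_cancel_right_pos)
    then show ?thesis by (simp add: abs_le_iff)
  qed
  then show ?thesis using C(1) by blast
qed

end

section \<open>Existence of a minimizer\<close>

locale kazdan_warner = weighted_graph G w \<mu>
  for G :: "'a pair_pre_digraph" and w \<mu> +
  fixes h :: "'a \<Rightarrow> real" and \<beta> :: real
  assumes h_pos: "\<And>x. x \<in> pverts G \<Longrightarrow> h x > 0"
begin

abbreviation J :: "('a \<Rightarrow> real) \<Rightarrow> real" where
  "J \<equiv> J_functional G w \<mu> h \<beta>"

abbreviation H :: "('a \<Rightarrow> real) set" where
  "H \<equiv> mean_zero_W12 G w \<mu>"

lemma J_eq: "J u = dirichlet_form u u / 2 - \<beta> * ln (\<integral>\<^sub>V (\<lambda>x. h x * exp (u x)))"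
  by (simp add: J_functional_def integral_grad_norm_sq)

lemma J_cong:
  assumes "\<And>x. x \<in> pverts G \<Longrightarrow> u x = v x"
  shows "J u = J v"
  using dirichlet_form_cong[OF assms] assms
    integral_cong[of "\<lambda>x. h x * exp (u x)" "\<lambda>x. h x * exp (v x)"]
  by (simp add: J_eq)

lemma H_eq: "H = {u \<in> pverts G \<rightarrow>\<^sub>E UNIV. \<integral>\<^sub>V u = 0}"
  by (auto simp: mean_zero_W12_def W12_def)

lemma integral_h_exp_pos: "\<integral>\<^sub>V (\<lambda>x. h x * exp (u x)) > 0"
  by (intro integral_pos mult_pos_pos h_pos) auto

lemma abs_ln_integral_h_exp_le:
  assumes "\<And>x. x \<in> pverts G \<Longrightarrow> \<bar>u x\<bar> \<le> M"
  shows "\<bar>ln (\<integral>\<^sub>V (\<lambda>x. h x * exp (u x)))\<bar> \<le> \<bar>ln (\<integral>\<^sub>V h)\<bar> + M"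
proof -
  let ?Z = "\<integral>\<^sub>V (\<lambda>x. h x * exp (u x))"
  have I: "\<integral>\<^sub>V h > 0" by (intro integral_pos h_pos)
  have "\<integral>\<^sub>V (\<lambda>x. exp (- M) * h x) \<le> ?Z"
    using assms h_pos by (intro integral_mono) (fastforce simp: mult.commute abs_le_iff)
  then have "ln (exp (- M) * \<integral>\<^sub>V h) \<le> ln ?Z"
    using I by (intro ln_mono) (auto simp: integral_cmult)
  moreover have "?Z \<le> \<integral>\<^sub>V (\<lambda>x. exp M * h x)"
    using assms h_pos by (intro integral_mono) (fastforce simp: mult.commute abs_le_iff)
  then have "ln ?Z \<le> ln (exp M * \<integral>\<^sub>V h)"
    using integral_h_exp_pos by (intro ln_mono) (auto simp: integral_cmult)
  ultimately show ?thesis using I by (simp add: ln_mult)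
qed

text \<open>
  Coercivity. With \<open>s = \<surd>E(u)\<close>, the Poincare inequality turns \<open>J u \<le> a\<close> into a quadratic inequality
  \<open>s\<^sup>2/2 \<le> a + |\<beta>| (L + C s)\<close>, which bounds \<open>s\<close> and then \<open>u\<close> itself.
\<close>

lemma J_sublevel_bounded:
  "\<exists>R\<ge>0. \<forall>u. \<integral>\<^sub>V u = 0 \<longrightarrow> J u \<le> a \<longrightarrow> (\<forall>x\<in>pverts G. \<bar>u x\<bar> \<le> R)"
proof -
  obtain C where C: "C \<ge> 0"
      "\<And>u x. \<integral>\<^sub>V u = 0 \<Longrightarrow> x \<in> pverts G \<Longrightarrow> \<bar>u x\<bar> \<le> C * sqrt (dirichlet_form u u)"
    using poincare_sup by blast
  define L where "L = \<bar>ln (\<integral>\<^sub>V h)\<bar>"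
  define A where "A = \<bar>a\<bar> + \<bar>\<beta>\<bar> * (L + C)"
  have A: "A \<ge> 0" using C(1) by (simp add: A_def L_def)
  have "\<bar>u x\<bar> \<le> C * (1 + 2 * A)" if u: "\<integral>\<^sub>V u = 0" "J u \<le> a" and x: "x \<in> pverts G" for u x
  proof -
    define s where "s = sqrt (dirichlet_form u u)"
    have s: "s \<ge> 0" "s\<^sup>2 = dirichlet_form u u" by (auto simp: s_def dirichlet_form_nonneg)
    let ?l = "ln (\<integral>\<^sub>V (\<lambda>x. h x * exp (u x)))"
    have "\<bar>?l\<bar> \<le> L + C * s"
      unfolding L_def s_def using C(2)[OF u(1)] by (rule abs_ln_integral_h_exp_le)
    then have "\<bar>\<beta> * ?l\<bar> \<le> \<bar>\<beta>\<bar> * (L + C * s)" by (simp add: abs_mult mult_left_mono)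
    then have le: "s\<^sup>2 / 2 \<le> a + \<bar>\<beta>\<bar> * (L + C * s)" using u(2) s(2) by (simp add: J_eq)
    have "s \<le> 1 + 2 * A"
    proof (cases "s \<le> 1")
      case False
      \<comment> \<open>For \<open>s > 1\<close> the constant terms are dominated by linear ones, and one factor \<open>s\<close> cancels.\<close>
      have "a \<le> \<bar>a\<bar> * s" using False mult_left_mono[of 1 s "\<bar>a\<bar>"] by simp
      moreover have "L \<le> L * s" using False mult_left_mono[of 1 s L] by (simp add: L_def)
      then have "\<bar>\<beta>\<bar> * (L + C * s) \<le> \<bar>\<beta>\<bar> * ((L + C) * s)"
        by (intro mult_left_mono) (auto simp: distrib_right)
      moreover have "A * s = \<bar>a\<bar> * s + \<bar>\<beta>\<bar> * ((L + C) * s)"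
        by (simp add: A_def distrib_right mult.assoc)
      ultimately have "s\<^sup>2 / 2 \<le> A * s" using le by linarith
      then have "s \<le> 2 * A" using False by (simp add: power2_eq_square)
      then show ?thesis by simp
    qed (use A in simp)
    then have "C * s \<le> C * (1 + 2 * A)" using C(1) by (intro mult_left_mono)
    then show ?thesis using C(2)[OF u(1) x] by (simp add: s_def)
  qed
  moreover have "C * (1 + 2 * A) \<ge> 0" using C(1) A by simp
  ultimately show ?thesis by blast
qed

lemma continuous_J: "continuous_on A J"
proof -
  have "\<integral>\<^sub>V (\<lambda>x. h x * exp (u x)) \<noteq> 0" for u
    using integral_h_exp_pos[of u] by simp
  then show ?thesis
    unfolding J_eq
    by (intro continuous_intros continuous_dirichlet_form continuous_integral
        continuous_on_product_coordinates[THEN continuous_on_subset]) auto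
qed

text \<open>
  Off the vertices an extensional function takes the single value \<open>undefined\<close>, so a box of
  extensional functions is a product of compact sets and Tychonoff's theorem applies.
\<close>

lemma compact_extensional_box: "compact (pverts G \<rightarrow>\<^sub>E {- R..R::real})"
proof -
  let ?S = "\<lambda>x. if x \<in> pverts G then {- R..R} else {undefined}"
  have "compactin (product_topology (\<lambda>_. euclidean) UNIV) (Pi\<^sub>E UNIV ?S)"
    by (subst compactin_PiE) auto
  moreover have "Pi\<^sub>E UNIV ?S = (pverts G \<rightarrow>\<^sub>E {- R..R})"
    by (fastforce simp: PiE_def Pi_def extensional_def split: if_splits)
  ultimately show ?thesis by (simp add: euclidean_product_topology)
qed

text \<open>
  The minimum is attained on the part of \<open>H\<close> inside a box that contains every \<open>v \<in> H\<close> with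
  \<open>J v \<le> J 0\<close>: outside the box, \<open>J\<close> already exceeds its value at \<open>0\<close>.
\<close>

lemma J_minimizer_exists: "\<exists>u\<in>H. \<forall>v\<in>H. J u \<le> J v"
proof -
  define z :: "'a \<Rightarrow> real" where "z = restrict (\<lambda>_. 0) (pverts G)"
  obtain R where R: "R \<ge> 0"
      "\<And>u x. \<integral>\<^sub>V u = 0 \<Longrightarrow> J u \<le> J z \<Longrightarrow> x \<in> pverts G \<Longrightarrow> \<bar>u x\<bar> \<le> R"
    using J_sublevel_bounded[of "J z"] by blast
  define K where "K = (pverts G \<rightarrow>\<^sub>E {- R..R}) \<inter> {u. \<integral>\<^sub>V u = 0}"
  have "closed {u. \<integral>\<^sub>V u = 0}"
    by (intro closed_Collect_eq continuous_integral continuous_on_product_coordinates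
        continuous_on_const)
  then have "compact K"
    unfolding K_def by (intro compact_Int_closed compact_extensional_box)
  moreover have zK: "z \<in> K" using R(1) by (auto simp: K_def z_def vintegral_def)
  ultimately obtain u where u: "u \<in> K" "\<And>v. v \<in> K \<Longrightarrow> J u \<le> J v"
    using continuous_attains_inf[OF _ _ continuous_J, of K] by blast
  have "u \<in> H" using u(1) by (auto simp: K_def H_eq PiE_iff)
  moreover have "J u \<le> J v" if v: "v \<in> H" for v
  proof (cases "J v \<le> J z")
    case True
    then have "v \<in> K"
      using v R(2)[of v] by (auto simp: H_eq K_def PiE_iff abs_le_iff minus_le_iff)
    then show ?thesis by (rule u(2))
  next
    case False
    then show ?thesis using u(2)[OF zK] by simp
  qed
  ultimately show ?thesis by blast
qed

section \<open>The Euler-Lagrange equation\<close>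

lemma J_minimizer_stationary:
  assumes min: "\<And>v. \<integral>\<^sub>V v = 0 \<Longrightarrow> J u \<le> J v"
    and u: "\<integral>\<^sub>V u = 0" and \<phi>: "\<integral>\<^sub>V \<phi> = 0"
  shows "dirichlet_form u \<phi>
     = \<beta> * \<integral>\<^sub>V (\<lambda>x. h x * exp (u x) * \<phi> x) / \<integral>\<^sub>V (\<lambda>x. h x * exp (u x))"
proof -
  let ?j = "\<lambda>t. J (\<lambda>x. u x + t * \<phi> x)"
  let ?Z = "\<lambda>t. \<integral>\<^sub>V (\<lambda>x. h x * exp (u x + t * \<phi> x))"
  let ?d = "dirichlet_form u \<phi>
      - \<beta> * (\<integral>\<^sub>V (\<lambda>x. h x * exp (u x) * \<phi> x) / \<integral>\<^sub>V (\<lambda>x. h x * exp (u x)))"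
  have "(?Z has_real_derivative \<integral>\<^sub>V (\<lambda>x. h x * exp (u x) * \<phi> x)) (at 0)"
    unfolding vintegral_def by (rule derivative_eq_intros refl | simp add: algebra_simps)+
  then have ln_Z: "((\<lambda>t. ln (?Z t)) has_real_derivative
      (\<integral>\<^sub>V (\<lambda>x. h x * exp (u x) * \<phi> x) / \<integral>\<^sub>V (\<lambda>x. h x * exp (u x)))) (at 0)"
    using integral_h_exp_pos[of u] by (auto intro!: derivative_eq_intros)
  have energy: "((\<lambda>t. (dirichlet_form u u + 2 * t * dirichlet_form u \<phi> + t\<^sup>2 * dirichlet_form \<phi> \<phi>) / 2)
      has_real_derivative dirichlet_form u \<phi>) (at 0)"
    by (auto intro!: derivative_eq_intros)
  have "(?j has_real_derivative ?d) (at 0)"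
    unfolding J_eq dirichlet_form_along_line
    by (intro DERIV_diff energy DERIV_cmult ln_Z)
  moreover have "\<forall>t. \<bar>0 - t\<bar> < 1 \<longrightarrow> ?j 0 \<le> ?j t"
    using min u \<phi> by (auto intro!: min simp: integral_add integral_cmult)
  ultimately have "?d = 0" by (intro DERIV_local_min[of ?j _ 0 1]) auto
  then show ?thesis by simp
qed

text \<open>
  A function orthogonal to all mean-zero functions is constant: it is orthogonal to its own
  deviation from its mean.
\<close>

lemma orthogonal_mean_zero_imp_const:
  assumes "\<And>\<phi>. \<integral>\<^sub>V \<phi> = 0 \<Longrightarrow> \<integral>\<^sub>V (\<lambda>x. F x * \<phi> x) = 0" "x \<in> pverts G"
  shows "F x = \<integral>\<^sub>V F / vol G \<mu>"
proof -
  define m where "m = \<integral>\<^sub>V F / vol G \<mu>"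
  let ?\<phi> = "\<lambda>x. F x + - m"
  have \<phi>: "\<integral>\<^sub>V ?\<phi> = 0"
    unfolding integral_add integral_const using vol_pos by (simp add: m_def)
  have "\<integral>\<^sub>V (\<lambda>x. (?\<phi> x)\<^sup>2) = \<integral>\<^sub>V (\<lambda>x. F x * ?\<phi> x + - m * ?\<phi> x)"
    by (rule integral_cong) (simp add: power2_eq_square algebra_simps)
  also have "\<dots> = 0" unfolding integral_add[of "\<lambda>x. F x * ?\<phi> x"] integral_cmult[of "- m"]
    using assms(1)[OF \<phi>] \<phi> by simp
  finally show ?thesis using integral_square_eq_0D[OF _ assms(2), of ?\<phi>] by (simp add: m_def)
qed

lemma J_minimizer_solves:
  assumes uH: "u \<in> H" and min: "\<And>v. v \<in> H \<Longrightarrow> J u \<le> J v"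
  shows "kazdan_warner_solution G w \<mu> h \<beta> u"
proof -
  have u: "\<integral>\<^sub>V u = 0" using uH by (simp add: H_eq)
  \<comment> \<open>\<open>u + t \<phi>\<close> need not be extensional, so it is restricted first; \<open>J\<close> sees only the vertices.\<close>
  have min': "J u \<le> J v" if "\<integral>\<^sub>V v = 0" for v
  proof -
    have "\<integral>\<^sub>V (restrict v (pverts G)) = 0"
      using integral_cong[of "restrict v (pverts G)" v] that by simp
    then have "restrict v (pverts G) \<in> H" by (auto simp: H_eq)
    then have "J u \<le> J (restrict v (pverts G))" by (rule min)
    also have "\<dots> = J v" by (rule J_cong) simp
    finally show ?thesis .
  qed
  define Z where "Z = \<integral>\<^sub>V (\<lambda>x. h x * exp (u x))"
  define F where "F x = laplacian G w \<mu> u x + \<beta> / Z * (h x * exp (u x))" for x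
  have "\<integral>\<^sub>V (\<lambda>x. F x * \<phi> x) = 0" if "\<integral>\<^sub>V \<phi> = 0" for \<phi>
  proof -
    have "\<integral>\<^sub>V (\<lambda>x. F x * \<phi> x) =
        \<integral>\<^sub>V (\<lambda>x. laplacian G w \<mu> u x * \<phi> x + \<beta> / Z * (h x * exp (u x) * \<phi> x))"
      by (rule integral_cong) (simp add: F_def algebra_simps)
    also have "\<dots> = - dirichlet_form u \<phi> + \<beta> / Z * \<integral>\<^sub>V (\<lambda>x. h x * exp (u x) * \<phi> x)"
      by (simp only: integral_add integral_cmult green)
    also have "\<dots> = 0" using J_minimizer_stationary[OF min' u that] by (simp add: Z_def)
    finally show ?thesis .
  qed
  then have const: "F x = \<integral>\<^sub>V F / vol G \<mu>" if "x \<in> pverts G" for x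
    using that by (rule orthogonal_mean_zero_imp_const)
  have "\<integral>\<^sub>V F = \<integral>\<^sub>V (laplacian G w \<mu> u) + \<beta> / Z * Z"
    unfolding F_def Z_def by (simp only: integral_add integral_cmult)
  also have "\<dots> = \<beta>"
    using integral_h_exp_pos[of u] by (simp add: integral_laplacian Z_def)
  finally have "\<integral>\<^sub>V F = \<beta>" .
  then have "laplacian G w \<mu> u x = - (\<beta> * h x * exp (u x) / Z) + \<beta> / vol G \<mu>"
    if "x \<in> pverts G" for x
    using const[OF that] by (simp add: F_def algebra_simps)
  then show ?thesis by (simp add: kazdan_warner_solution_def Z_def)
qed

end

theorem theorem2p1:
  fixes G :: "'a pair_pre_digraph"
    and w :: "'a \<Rightarrow> 'a \<Rightarrow> real"
    and \<mu> h :: "'a \<Rightarrow> real"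
    and \<beta> :: real
  assumes "pair_pseudo_graph G"
    and "Digraph_Component.connected (with_proj G)"
    and "\<And>x y. (x, y) \<in> parcs G \<Longrightarrow> w x y > 0"
    and "\<And>x y. (x, y) \<in> parcs G \<Longrightarrow> w x y = w y x"
    and "\<And>x. x \<in> pverts G \<Longrightarrow> \<mu> x > 0"
    and "\<And>x. x \<in> pverts G \<Longrightarrow> h x > 0"
  shows "(\<exists>u\<in>mean_zero_W12 G w \<mu>.
            bdd_below (J_functional G w \<mu> h \<beta> ` mean_zero_W12 G w \<mu>) \<and>
            J_functional G w \<mu> h \<beta> u = (INF v\<in>mean_zero_W12 G w \<mu>. J_functional G w \<mu> h \<beta> v)) \<and>
         (\<exists>u\<in>mean_zero_W12 G w \<mu>. kazdan_warner_solution G w \<mu> h \<beta> u)"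
proof -
  interpret kazdan_warner G w \<mu> h \<beta>
    using assms
    by (intro kazdan_warner.intro weighted_graph.intro weighted_graph_axioms.intro
        kazdan_warner_axioms.intro)
  obtain u where u: "u \<in> H" "\<And>v. v \<in> H \<Longrightarrow> J u \<le> J v"
    using J_minimizer_exists by blast
  have "bdd_below (J ` H)" using u(2) by (intro bdd_belowI2)
  moreover have "J u = (INF v\<in>H. J v)"
    using u by (intro cInf_eq_minimum[symmetric]) auto
  ultimately show ?thesis using u(1) J_minimizer_solves[OF u] by blast
qed

end
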